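(* If an $n$-player finite game has a unique correlated equilibrium $\sigma$, then $\sigma$ is a quasi-strict Nash equilibrium.
   Context: A finite $n$-player game has player set $I=\{1,\dots,n\}$, finite nonempty pure strategy sets $S^i$ ($i\in I$), $S=\times_{i\in I}S^i$, $S^{-i}=\times_{j\ne i}S^j$, and utility functions $U^i:S\to\mathbb{R}$, extended multilinearly to mixed strategies. A correlated equilibrium is a probability distribution $\mu$ on $S$ such that for all $i\in I$ and all $s^i,t^i\in S^i$, $$\sum_{s^{-i}\in S^{-i}}\mu(s^i,s^{-i})\,[U^i(s^i,s^{-i})-U^i(t^i,s^{-i})]\ge 0 .$$ A mixed strategy profile $(\sigma^i)_{i\in I}$ is identified with the product distribution $\otimes_i\sigma^i$ on $S$; thus saying that a distribution on $S$ is a Nash equilibrium means that it is the product distribution of a Nash equilibrium in mixed strategies. A Nash equilibrium $\sigma=(\sigma^i)_{i\in I}$ is quasi-strict if for every player $i$, every pure best response of player $i$ to $\sigma^{-i}$ belongs to the support of $\sigma^i$, i.e. $\{s^i\in S^i:\ U^i(s^i,\sigma^{-i})\ge U^i(t^i,\sigma^{-i})\ \forall t^i\in S^i\}\subseteq\{s^i:\sigma^i(s^i)>0\}$. *)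

theory Defs
  imports "HOL-Probability.Probability"
begin

text \<open>
  Conventions. A game is given by a player set \<open>I\<close>, strategy sets \<open>S i\<close> and payoff functions
  \<open>U i\<close>. The set of pure profiles is the extensional product \<open>PiE I S\<close>, and the set of
  profiles of the opponents of \<open>i\<close> is \<open>PiE (I - {i}) S\<close>; the profile \<open>(s, r)\<close> with
  \<open>s \<in> S i\<close> and \<open>r \<in> PiE (I - {i}) S\<close> is \<open>r(i := s)\<close>. Values of \<open>S\<close>, of \<open>U\<close> and of
  mixed profiles at indices outside \<open>I\<close> are irrelevant, and so are payoffs outside
  \<open>PiE I S\<close>.
\<close>

definition correlated_equilibrium ::
  "'i set \<Rightarrow> ('i \<Rightarrow> 's set) \<Rightarrow> ('i \<Rightarrow> ('i \<Rightarrow> 's) \<Rightarrow> real) \<Rightarrow> ('i \<Rightarrow> 's) pmf \<Rightarrow> bool" where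
  "correlated_equilibrium I S U \<mu> \<longleftrightarrow>
     set_pmf \<mu> \<subseteq> PiE I S \<and>
     (\<forall>i\<in>I. \<forall>s\<in>S i. \<forall>t\<in>S i.
        (\<Sum>r\<in>PiE (I - {i}) S. pmf \<mu> (r(i := s)) * (U i (r(i := s)) - U i (r(i := t)))) \<ge> 0)"

definition mixed_profile :: "'i set \<Rightarrow> ('i \<Rightarrow> 's set) \<Rightarrow> ('i \<Rightarrow> 's pmf) \<Rightarrow> bool" where
  "mixed_profile I S \<sigma> \<longleftrightarrow> (\<forall>i\<in>I. set_pmf (\<sigma> i) \<subseteq> S i)"

text \<open>
  The default value \<open>undefined\<close> makes the product distribution live on the extensional product;
  it is meaningful only for finite \<open>I\<close>.
\<close>

definition product_dist :: "'i set \<Rightarrow> ('i \<Rightarrow> 's pmf) \<Rightarrow> ('i \<Rightarrow> 's) pmf" where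
  "product_dist I \<sigma> = Pi_pmf I undefined \<sigma>"

definition mixed_payoff ::
  "'i set \<Rightarrow> ('i \<Rightarrow> ('i \<Rightarrow> 's) \<Rightarrow> real) \<Rightarrow> 'i \<Rightarrow> ('i \<Rightarrow> 's pmf) \<Rightarrow> real" where
  "mixed_payoff I U i \<sigma> = measure_pmf.expectation (product_dist I \<sigma>) (U i)"

definition nash_equilibrium ::
  "'i set \<Rightarrow> ('i \<Rightarrow> 's set) \<Rightarrow> ('i \<Rightarrow> ('i \<Rightarrow> 's) \<Rightarrow> real) \<Rightarrow> ('i \<Rightarrow> 's pmf) \<Rightarrow> bool" where
  "nash_equilibrium I S U \<sigma> \<longleftrightarrow>
     mixed_profile I S \<sigma> \<and>
     (\<forall>i\<in>I. \<forall>\<tau>. set_pmf \<tau> \<subseteq> S i \<longrightarrow>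
        mixed_payoff I U i (\<sigma>(i := \<tau>)) \<le> mixed_payoff I U i \<sigma>)"

definition pure_best_responses ::
  "'i set \<Rightarrow> ('i \<Rightarrow> 's set) \<Rightarrow> ('i \<Rightarrow> ('i \<Rightarrow> 's) \<Rightarrow> real) \<Rightarrow> 'i \<Rightarrow> ('i \<Rightarrow> 's pmf) \<Rightarrow> 's set" where
  "pure_best_responses I S U i \<sigma> =
     {s \<in> S i. \<forall>t\<in>S i. mixed_payoff I U i (\<sigma>(i := return_pmf s))
                       \<ge> mixed_payoff I U i (\<sigma>(i := return_pmf t))}"

definition quasi_strict_nash_equilibrium ::
  "'i set \<Rightarrow> ('i \<Rightarrow> 's set) \<Rightarrow> ('i \<Rightarrow> ('i \<Rightarrow> 's) \<Rightarrow> real) \<Rightarrow> ('i \<Rightarrow> 's pmf) \<Rightarrow> bool" where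
  "quasi_strict_nash_equilibrium I S U \<sigma> \<longleftrightarrow>
     nash_equilibrium I S U \<sigma> \<and>
     (\<forall>i\<in>I. pure_best_responses I S U i \<sigma> \<subseteq> set_pmf (\<sigma> i))"

lemma set_pmf_product_dist:
  assumes "finite I" "mixed_profile I S \<sigma>"
  shows "set_pmf (product_dist I \<sigma>) \<subseteq> PiE I S"
  using assms unfolding product_dist_def mixed_profile_def
  by (auto simp: set_Pi_pmf PiE_dflt_def PiE_def extensional_def Pi_def)

lemma mixed_payoff_eq_sum:
  assumes "finite I" "\<And>i. i \<in> I \<Longrightarrow> finite (S i)" "mixed_profile I S \<sigma>"
  shows "mixed_payoff I U i \<sigma> = (\<Sum>s\<in>PiE I S. (\<Prod>j\<in>I. pmf (\<sigma> j) (s j)) * U i s)"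
proof -
  have "mixed_payoff I U i \<sigma> = (\<Sum>s\<in>PiE I S. pmf (product_dist I \<sigma>) s *\<^sub>R U i s)"
    unfolding mixed_payoff_def
    using set_pmf_product_dist[OF assms(1,3)] assms(1,2)
    by (intro integral_measure_pmf) (auto intro: finite_PiE)
  also have "\<dots> = (\<Sum>s\<in>PiE I S. (\<Prod>j\<in>I. pmf (\<sigma> j) (s j)) * U i s)"
    using assms(1)
    by (intro sum.cong) (auto simp: product_dist_def pmf_Pi PiE_def extensional_def)
  finally show ?thesis .
qed

end

theory Submission
  imports Defs
begin

text \<open>
  A Nash equilibrium \<open>\<sigma>\<close> exists by Brouwer's theorem, its product distribution is a correlated
  equilibrium, and so it is \<open>\<mu>\<close>. By linear programming duality with strict complementarity,
  uniqueness yields transition rates \<open>\<alpha> i s t \<ge> 0\<close> and multipliers \<open>\<beta> p \<ge> 0\<close> that annihilate the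
  system of incentive and positivity constraints, with \<open>\<alpha> i s t > 0\<close> or \<open>\<beta> p > 0\<close> whenever the
  corresponding constraint is tight at \<open>\<mu>\<close>. Evaluated at a product \<open>\<tau>\<close> of \<open>\<alpha>\<close>-stationary
  distributions, the incentive terms cancel, so \<open>\<beta>\<close> vanishes on the support of \<open>\<tau>\<close>, and this support
  lies in that of \<open>\<mu>\<close>. If \<open>t\<close> is a best response of player \<open>k\<close>, then \<open>\<alpha> k s t > 0\<close> for all \<open>s\<close>, hence
  \<open>\<tau> k t > 0\<close>, and \<open>t\<close> is in the support of \<open>\<sigma> k\<close>.
\<close>

section \<open>Linear functionals and Farkas' lemma\<close>

text \<open>One identity encodes linearity: \<open>c = 1\<close> gives additivity, and
  \<open>x = y\<close> with \<open>c = -1\<close> gives value 0 at the zero function, hence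
  homogeneity.\<close>

definition linear_functional :: "(('a \<Rightarrow> real) \<Rightarrow> real) \<Rightarrow> bool" where
  "linear_functional f \<longleftrightarrow> (\<forall>c x y. f (\<lambda>a. x a + c * y a) = f x + c * f y)"

text \<open>
  Bartl's induction: if the constraint \<open>f j\<close> cannot be dropped, a violating point \<open>z\<close> has \<open>f j z < 0\<close>,
  and projecting along \<open>z\<close> onto the kernel of \<open>f j\<close> eliminates \<open>f j\<close>.
\<close>

lemma farkas_functionals:
  fixes g :: "('a \<Rightarrow> real) \<Rightarrow> real" and f :: "'k \<Rightarrow> ('a \<Rightarrow> real) \<Rightarrow> real"
  assumes "finite K"
    and "linear_functional g"
    and "\<And>k. k \<in> K \<Longrightarrow> linear_functional (f k)"
    and "\<And>x. (\<And>k. k \<in> K \<Longrightarrow> 0 \<le> f k x) \<Longrightarrow> 0 \<le> g x"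
  shows "\<exists>c. (\<forall>k\<in>K. 0 \<le> c k) \<and> (\<forall>x. g x = (\<Sum>k\<in>K. c k * f k x))"
  using assms
proof (induction K arbitrary: f g rule: finite_induct)
  case empty
  have lin: "g (\<lambda>a. x a + c * y a) = g x + c * g y" for c x y
    using empty.prems(1) by (simp add: linear_functional_def)
  have "g x = 0" for x
  proof -
    \<comment> \<open>Without constraints \<open>g\<close> is nonnegative everywhere. The negative
      of \<open>x\<close> is written as \<open>x + (-2) x\<close> to fit the form of
      \<open>lin\<close>.\<close>
    have "0 \<le> g (\<lambda>a. x a + (-2) * x a)" "0 \<le> g x"
      using empty.prems by auto
    then show ?thesis
      unfolding lin by simp
  qed
  then show ?case by simp
next
  case (insert j K)
  have lin_g: "g (\<lambda>a. x a + c * y a) = g x + c * g y" for c x y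
    using insert.prems(1) by (simp add: linear_functional_def)
  have lin_f: "f k (\<lambda>a. x a + c * y a) = f k x + c * f k y" if "k \<in> insert j K" for k c x y
    using insert.prems(2)[OF that] by (simp add: linear_functional_def)
  show ?case
  proof (cases "\<forall>x. (\<forall>k\<in>K. 0 \<le> f k x) \<longrightarrow> 0 \<le> g x")
    case True
    then obtain c where c: "\<forall>k\<in>K. 0 \<le> c k" "\<And>x. g x = (\<Sum>k\<in>K. c k * f k x)"
      using insert.IH[of g f] insert.prems by auto
    have "g x = (\<Sum>k\<in>insert j K. (c(j := 0)) k * f k x)" for x
      using insert.hyps c(2)[of x] by (auto intro!: sum.cong)
    with c(1) show ?thesis
      by (intro exI[of _ "c(j := 0)"]) auto
  next
    case False
    then obtain z where z: "\<And>k. k \<in> K \<Longrightarrow> 0 \<le> f k z" "g z < 0"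
      by force
    with insert.prems(3)[of z] have neg: "f j z < 0"
      by force
    define d where "d = - f j z"
    have d: "d > 0" using neg by (simp add: d_def)
    \<comment> \<open>\<open>g'\<close> and \<open>f'\<close> are \<open>g\<close> and
      \<open>f\<close> evaluated at the projected point \<open>?y\<close> below.\<close>
    define g' where "g' = (\<lambda>x. g x + f j x / d * g z)"
    define f' where "f' = (\<lambda>k x. f k x + f j x / d * f k z)"
    have "\<exists>c. (\<forall>k\<in>K. 0 \<le> c k) \<and> (\<forall>x. g' x = (\<Sum>k\<in>K. c k * f' k x))"
    proof (rule insert.IH)
      show "linear_functional g'"
        using d by (simp add: linear_functional_def g'_def lin_g lin_f field_simps)
      show "linear_functional (f' k)" if "k \<in> K" for k
        using d that by (simp add: linear_functional_def f'_def lin_f field_simps)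
      fix x assume x: "\<And>k. k \<in> K \<Longrightarrow> 0 \<le> f' k x"
      let ?y = "\<lambda>a. x a + f j x / d * z a"
      have "f j ?y = 0"
        using d by (subst lin_f) (auto simp: d_def field_simps)
      moreover have "0 \<le> f k ?y" if "k \<in> K" for k
        unfolding lin_f[OF insertI2[OF that]] using x[OF that] by (simp add: f'_def)
      ultimately have "0 \<le> g ?y"
        by (intro insert.prems(3)) auto
      then show "0 \<le> g' x"
        unfolding lin_g by (simp add: g'_def)
    qed
    then obtain c where c: "\<forall>k\<in>K. 0 \<le> c k" "\<And>x. g' x = (\<Sum>k\<in>K. c k * f' k x)"
      by blast
    \<comment> \<open>Expanding \<open>g' x = (\<Sum>k\<in>K. c k * f' k x)\<close> leaves exactly
      \<open>b\<close> as the coefficient of \<open>f j x\<close>. It is nonnegative since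
      \<open>g z < 0\<close> while every \<open>f k z\<close> is nonnegative.\<close>
    define b where "b = ((\<Sum>k\<in>K. c k * f k z) - g z) / d"
    have "0 \<le> (\<Sum>k\<in>K. c k * f k z)"
      using c(1) z(1) by (intro sum_nonneg) simp
    then have "0 \<le> b"
      using d z(2) by (simp add: b_def)
    have "g x = (\<Sum>k\<in>insert j K. (c(j := b)) k * f k x)" for x
    proof -
      have "g x = g' x - f j x / d * g z"
        by (simp add: g'_def)
      also have "\<dots> = (\<Sum>k\<in>K. c k * f k x) + b * f j x"
        using d by (simp add: c(2) f'_def b_def algebra_simps sum.distrib
            sum_distrib_left sum_divide_distrib diff_divide_distrib)
      also have "\<dots> = (\<Sum>k\<in>insert j K. (c(j := b)) k * f k x)"
      proof -
        have "(\<Sum>k\<in>K. c k * f k x) = (\<Sum>k\<in>K. (c(j := b)) k * f k x)"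
          using insert.hyps by (intro sum.cong) auto
        then show ?thesis
          using insert.hyps by simp
      qed
      finally show ?thesis .
    qed
    with c(1) \<open>0 \<le> b\<close> show ?thesis
      by (intro exI[of _ "c(j := b)"]) auto
  qed
qed

text \<open>
  If \<open>f t\<close> vanishes on the cone, then Farkas' lemma applies to \<open>- f t\<close>; moving \<open>f t\<close> to the other
  side gives it a coefficient at least 1. Summing over \<open>T\<close> makes all these coefficients positive.
\<close>

lemma complementary_multipliers:
  fixes f :: "'k \<Rightarrow> ('a \<Rightarrow> real) \<Rightarrow> real"
  assumes "finite K" "T \<subseteq> K"
    and lin: "\<And>k. k \<in> K \<Longrightarrow> linear_functional (f k)"
    and tight: "\<And>x k. (\<And>k. k \<in> K \<Longrightarrow> 0 \<le> f k x) \<Longrightarrow> k \<in> T \<Longrightarrow> f k x = 0"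
  shows "\<exists>c. (\<forall>k\<in>K. 0 \<le> c k) \<and> (\<forall>k\<in>T. 0 < c k) \<and> (\<forall>x. (\<Sum>k\<in>K. c k * f k x) = 0)"
proof -
  have "\<exists>c. (\<forall>k\<in>K. 0 \<le> c k) \<and> (\<forall>x. - f t x = (\<Sum>k\<in>K. c k * f k x))" if t: "t \<in> T" for t
  proof (rule farkas_functionals)
    show "linear_functional (\<lambda>x. - f t x)"
      using lin[of t] t assms(2) by (auto simp: linear_functional_def)
    show "0 \<le> - f t x" if "\<And>k. k \<in> K \<Longrightarrow> 0 \<le> f k x" for x
      using tight[OF that t] by simp
  qed (use assms(1) lin in simp_all)
  then obtain c where c: "\<And>t k. t \<in> T \<Longrightarrow> k \<in> K \<Longrightarrow> 0 \<le> c t k"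
    "\<And>t x. t \<in> T \<Longrightarrow> - f t x = (\<Sum>k\<in>K. c t k * f k x)"
    by metis
  define d where "d = (\<lambda>k. (\<Sum>t\<in>T. c t k) + (if k \<in> T then 1 else 0))"
  have nn: "0 \<le> (\<Sum>t\<in>T. c t k)" if "k \<in> K" for k
    using c(1) that by (intro sum_nonneg) auto
  have "(\<Sum>k\<in>K. d k * f k x) = 0" for x
  proof -
    have "(\<Sum>k\<in>K. (\<Sum>t\<in>T. c t k) * f k x) = (\<Sum>t\<in>T. - f t x)"
      by (simp only: c(2) sum_distrib_right cong: sum.cong) (rule sum.swap)
    moreover have "(\<Sum>k\<in>K. (if k \<in> T then 1 else 0) * f k x) = (\<Sum>t\<in>T. f t x)"
    proof -
      have "(\<Sum>k\<in>K. (if k \<in> T then 1 else 0) * f k x) = (\<Sum>k\<in>K. if k \<in> T then f k x else 0)"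
        by (intro sum.cong) auto
      also have "\<dots> = (\<Sum>t\<in>K \<inter> T. f t x)"
        using assms(1) by (rule sum.inter_restrict[symmetric])
      finally show ?thesis
        using assms(2) by (simp add: Int_absorb1)
    qed
    ultimately show ?thesis
      by (simp add: d_def algebra_simps sum.distrib sum_negf)
  qed
  then show ?thesis
    using nn assms(2) by (intro exI[of _ d]) (auto simp: d_def add_nonneg_pos)
qed

section \<open>Stationary distributions of transition rates\<close>

text \<open>
  The rows of \<open>\<alpha>\<close> hold transition rates and need not sum to 1. By Farkas' lemma, nonexistence
  would give a function \<open>y\<close> whose expected change is negative at every state, which fails
  at a minimum of \<open>y\<close>.
\<close>

lemma stationary_distribution_exists:
  fixes \<alpha> :: "'a \<Rightarrow> 'a \<Rightarrow> real"
  assumes A: "finite A" "A \<noteq> {}" and nonneg: "\<And>a b. a \<in> A \<Longrightarrow> b \<in> A \<Longrightarrow> 0 \<le> \<alpha> a b"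
  shows "\<exists>\<tau>. (\<forall>a\<in>A. 0 \<le> \<tau> a) \<and> (\<Sum>a\<in>A. \<tau> a) = 1 \<and>
    (\<forall>t\<in>A. (\<Sum>a\<in>A. \<tau> a * \<alpha> a t) = \<tau> t * (\<Sum>b\<in>A. \<alpha> t b))"
proof -
  \<comment> \<open>Inflow into \<open>t\<close> minus outflow from \<open>t\<close> for the mass
    distribution \<open>x\<close>.\<close>
  define g where "g = (\<lambda>t x. (\<Sum>a\<in>A. \<alpha> a t * x a) - (\<Sum>b\<in>A. \<alpha> t b) * x t)"
  have lin_g: "linear_functional (g t)" for t
    unfolding g_def linear_functional_def
    by (simp add: algebra_simps sum.distrib sum_distrib_left)
  obtain x where x: "\<And>a. a \<in> A \<Longrightarrow> 0 \<le> x a" "\<And>t. t \<in> A \<Longrightarrow> g t x = 0" "0 < (\<Sum>a\<in>A. x a)"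
  proof (atomize_elim, rule ccontr)
    assume none: "\<nexists>x. (\<forall>a. a \<in> A \<longrightarrow> 0 \<le> x a) \<and> (\<forall>t. t \<in> A \<longrightarrow> g t x = 0) \<and> 0 < sum x A"
    \<comment> \<open>Tag 0 is the constraint \<open>0 \<le> x a\<close>; tags 1 and 2 are the two
      inequalities that make up \<open>g a x = 0\<close>.\<close>
    let ?K = "A \<times> {0, 1, 2 :: nat}"
    define f where "f = (\<lambda>k x. if snd k = 0 then x (fst k) else
        if snd k = Suc 0 then g (fst k) x else - g (fst k) x)"
    have "\<exists>c. (\<forall>k\<in>?K. 0 \<le> c k) \<and> (\<forall>x. - (\<Sum>a\<in>A. x a) = (\<Sum>k\<in>?K. c k * f k x))"
    proof (rule farkas_functionals)
      show "linear_functional (\<lambda>x. - (\<Sum>a\<in>A. x a))"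
        by (auto simp: linear_functional_def sum.distrib sum_distrib_left)
      show "linear_functional (f k)" for k
        using lin_g by (auto simp: linear_functional_def f_def)
      fix x assume x: "\<And>k. k \<in> ?K \<Longrightarrow> 0 \<le> f k x"
      have "0 \<le> x a" "g a x = 0" if "a \<in> A" for a
        using x[of "(a, 0)"] x[of "(a, 1)"] x[of "(a, 2)"] that by (auto simp: f_def)
      with none show "0 \<le> - (\<Sum>a\<in>A. x a)"
        by (metis linorder_not_less neg_0_le_iff_le)
    qed (use A in auto)
    then obtain c where c0: "\<forall>k\<in>?K. 0 \<le> c k"
      and c: "\<And>x. - (\<Sum>a\<in>A. x a) = (\<Sum>k\<in>?K. c k * f k x)"
      by blast
    \<comment> \<open>The multipliers of two opposite inequalities merge into one of arbitrary
      sign.\<close>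
    define y where "y = (\<lambda>t. c (t, 1) - c (t, 2))"
    have yc: "- (\<Sum>a\<in>A. x a) = (\<Sum>t\<in>A. c (t, 0) * x t + y t * g t x)" for x
      unfolding c sum.cartesian_product[symmetric, of "\<lambda>a b. c (a, b) * f (a, b) x", simplified]
      by (intro sum.cong) (auto simp: f_def y_def algebra_simps)
    obtain m where m: "m \<in> A" "\<And>a. a \<in> A \<Longrightarrow> y m \<le> y a"
      using arg_min_if_finite(1)[OF A, of y] arg_min_least[OF A, of _ y] by blast
    \<comment> \<open>Unit mass at the minimizer \<open>m\<close> of \<open>y\<close>: there the
      left side of \<open>yc\<close> is -1 and the right side is nonnegative.\<close>
    define e where "e = (\<lambda>a. if a = m then 1 else (0::real))"
    have e: "(\<Sum>a\<in>A. e a) = 1" "(\<Sum>a\<in>A. h a * e a) = h m" for h :: "'a \<Rightarrow> real"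
      using m(1) A(1) by (auto simp: e_def if_distrib cong: if_cong)
    have ge: "g t e = \<alpha> m t - (\<Sum>b\<in>A. \<alpha> t b) * e t" for t
      by (simp add: g_def e)
    have "- 1 = (\<Sum>t\<in>A. c (t, 0) * e t + (y t * \<alpha> m t - (y t * (\<Sum>b\<in>A. \<alpha> t b)) * e t))"
      using yc[of e] by (simp add: ge e(1) algebra_simps)
    also have "\<dots> = c (m, 0) + (\<Sum>t\<in>A. y t * \<alpha> m t) - y m * (\<Sum>b\<in>A. \<alpha> m b)"
      by (simp add: sum.distrib sum_subtractf e(2))
    also have "\<dots> = c (m, 0) + (\<Sum>t\<in>A. (y t - y m) * \<alpha> m t)"
      by (simp add: algebra_simps sum_subtractf sum_distrib_left)
    also have "\<dots> \<ge> 0"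
      using c0 m nonneg by (intro add_nonneg_nonneg sum_nonneg mult_nonneg_nonneg) auto
    finally show False by simp
  qed
  have "(\<Sum>a\<in>A. x a / sum x A * \<alpha> a t) = x t / sum x A * (\<Sum>b\<in>A. \<alpha> t b)" if "t \<in> A" for t
  proof -
    have "(\<Sum>a\<in>A. x a / sum x A * \<alpha> a t) = (\<Sum>a\<in>A. \<alpha> a t * x a) / sum x A"
      by (simp add: sum_divide_distrib mult.commute)
    then show ?thesis
      using x(2)[OF that] by (simp add: g_def mult.commute)
  qed
  with x show ?thesis
    by (intro exI[of _ "\<lambda>a. x a / sum x A"]) (auto simp: sum_divide_distrib[symmetric])
qed

section \<open>Brouwer's theorem for cubes of functions\<close>

text \<open>The function type carries the product topology. With the next lemma, this lets plain
  functions serve as the points of a cube.\<close>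

lemma tendsto_fun_componentwise:
  fixes X :: "'c \<Rightarrow> 'a \<Rightarrow> 'b::topological_space"
  assumes "\<And>i. ((\<lambda>n. X n i) \<longlongrightarrow> l i) F"
  shows "(X \<longlongrightarrow> l) F"
proof -
  have "limitin (product_topology (\<lambda>i. euclidean) UNIV) X l F"
    using assms by (auto simp: limitin_componentwise)
  then show ?thesis
    by (simp add: euclidean_product_topology)
qed

lemma compact_PiE_UNIV:
  fixes X :: "'a \<Rightarrow> 'b::topological_space set"
  assumes "\<And>i. compact (X i)"
  shows "compact (PiE UNIV X)"
proof -
  have "compactin (product_topology (\<lambda>i. euclidean) UNIV) (PiE UNIV X)"
    using assms by (subst compactin_PiE) auto
  then show ?thesis
    by (simp add: euclidean_product_topology)
qed

text \<open>
  Kuhn's lemma on grids of mesh \<open>1 / Suc p\<close> gives cells that have, for each coordinate \<open>i\<close>, a vertex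
  where \<open>f\<close> does not decrease and one where \<open>f\<close> does not increase the coordinate. A limit point of
  these cells is fixed. The dimension \<open>n\<close> is a number, not a type, because it depends on the game.
\<close>

lemma brouwer_coordinates:
  fixes f :: "(nat \<Rightarrow> real) \<Rightarrow> nat \<Rightarrow> real" and n :: nat
  defines "K \<equiv> {x. (\<forall>i<n. 0 \<le> x i \<and> x i \<le> 1) \<and> (\<forall>i\<ge>n. x i = 0)}"
  assumes cont: "\<And>i. i < n \<Longrightarrow> continuous_on K (\<lambda>x. f x i)"
    and maps: "\<And>x i. x \<in> K \<Longrightarrow> i < n \<Longrightarrow> 0 \<le> f x i \<and> f x i \<le> 1"
  shows "\<exists>x\<in>K. \<forall>i<n. f x i = x i"
proof -
  have K_PiE: "K = PiE UNIV (\<lambda>i. if i < n then {0..1} else {0})"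
    unfolding K_def set_eq_iff mem_Collect_eq PiE_UNIV_domain Pi_iff
    by (metis UNIV_I atLeastAtMost_iff leD leI singletonD singletonI)
  have "compact K"
    unfolding K_PiE by (rule compact_PiE_UNIV) auto
  then have seqK: "seq_compact K"
    by (rule compact_imp_seq_compact)
  \<comment> \<open>Label 0 means that \<open>f\<close> does not decrease the coordinate, label 1
    that it does not increase it. On the faces \<open>x i = 0\<close> and \<open>x i = 1\<close>
    Kuhn's lemma prescribes the label; this agrees with the meaning because \<open>f\<close> maps
    into the cube.\<close>
  define l where "l = (\<lambda>x i. if x i = 0 \<or> (x i \<noteq> 1 \<and> x i \<le> f x i) then 0 else (1::nat))"
  have l: "l x i = 0 \<or> l x i = 1" "x i = 0 \<Longrightarrow> l x i = 0" "x i = 1 \<Longrightarrow> l x i = 1"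
    "x \<in> K \<Longrightarrow> i < n \<Longrightarrow> l x i = 0 \<Longrightarrow> x i \<le> f x i"
    "x \<in> K \<Longrightarrow> i < n \<Longrightarrow> l x i = 1 \<Longrightarrow> f x i \<le> x i" for x i
    using maps[of x i] by (auto simp: l_def split: if_splits)
  define e where "e = (\<lambda>p (x::nat \<Rightarrow> nat) i. if i < n then real (x i) / real (Suc p) else 0)"
  have eK: "e p x \<in> K" if "\<And>i. i < n \<Longrightarrow> x i \<le> Suc p" for p x
    unfolding K_def e_def using that by (auto simp: divide_le_eq_1 simp flip: of_nat_Suc)
  have grid: "\<exists>q. (\<forall>i<n. q i < Suc p) \<and> (\<forall>i<n. \<exists>r s. (\<forall>j<n. q j \<le> r j \<and> r j \<le> q j + 1) \<and>
      (\<forall>j<n. q j \<le> s j \<and> s j \<le> q j + 1) \<and> l (e p r) i = 0 \<and> l (e p s) i = 1)" for p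
  proof -
    have 1: "\<forall>x. (\<forall>i<n. x i \<le> Suc p) \<longrightarrow> (\<forall>i<n. l (e p x) i = 0 \<or> l (e p x) i = 1)"
      using l(1) by blast
    have 2: "\<forall>x. (\<forall>i<n. x i \<le> Suc p) \<longrightarrow> (\<forall>i<n. x i = 0 \<longrightarrow> l (e p x) i = 0)"
      by (simp add: l(2) e_def)
    have 3: "\<forall>x. (\<forall>i<n. x i \<le> Suc p) \<longrightarrow> (\<forall>i<n. x i = Suc p \<longrightarrow> l (e p x) i = 1)"
    proof (intro allI impI)
      fix x :: "nat \<Rightarrow> nat" and i
      assume "\<forall>i<n. x i \<le> Suc p" "i < n" "x i = Suc p"
      then show "l (e p x) i = 1"
        by (intro l(3)) (simp add: e_def)
    qed
    obtain q where q: "\<forall>i<n. q i < Suc p"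
      "\<forall>i<n. \<exists>r s. (\<forall>j<n. q j \<le> r j \<and> r j \<le> q j + 1) \<and> (\<forall>j<n. q j \<le> s j \<and> s j \<le> q j + 1) \<and>
        l (e p r) i \<noteq> l (e p s) i"
      by (rule kuhn_lemma[of "Suc p" n "\<lambda>x. l (e p x)", OF _ 1 2 3]) auto
    have "\<exists>r s. (\<forall>j<n. q j \<le> r j \<and> r j \<le> q j + 1) \<and>
      (\<forall>j<n. q j \<le> s j \<and> s j \<le> q j + 1) \<and> l (e p r) i = 0 \<and> l (e p s) i = 1" if i: "i < n" for i
    proof -
      obtain r s where rs: "\<forall>j<n. q j \<le> r j \<and> r j \<le> q j + 1" "\<forall>j<n. q j \<le> s j \<and> s j \<le> q j + 1"
        "l (e p r) i \<noteq> l (e p s) i"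
        using q(2) i by blast
      \<comment> \<open>Kuhn's lemma only says that the labels differ; exchanging \<open>r\<close>
        and \<open>s\<close> if necessary puts label 0 at \<open>r\<close>.\<close>
      have "(l (e p r) i = 0 \<and> l (e p s) i = 1) \<or> (l (e p s) i = 0 \<and> l (e p r) i = 1)"
        using rs(3) l(1)[of "e p r" i] l(1)[of "e p s" i] by metis
      with rs(1,2) show ?thesis
        by blast
    qed
    with q(1) show ?thesis by blast
  qed
  then obtain q where q: "\<And>p i. i < n \<Longrightarrow> q p i < Suc p"
    and ex: "\<And>p i. i < n \<Longrightarrow> \<exists>r s. (\<forall>j<n. q p j \<le> r j \<and> r j \<le> q p j + 1) \<and>
      (\<forall>j<n. q p j \<le> s j \<and> s j \<le> q p j + 1) \<and> l (e p r) i = 0 \<and> l (e p s) i = 1"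
    by metis
  \<comment> \<open>The guard \<open>i < n\<close> makes the choice of \<open>r\<close> and
    \<open>s\<close> possible for every \<open>i\<close>.\<close>
  define P where "P = (\<lambda>p i r s. i < n \<longrightarrow> (\<forall>j<n. q p j \<le> r j \<and> r j \<le> q p j + 1) \<and>
      (\<forall>j<n. q p j \<le> s j \<and> s j \<le> q p j + 1) \<and> l (e p r) i = 0 \<and> l (e p s) i = 1)"
  have "\<exists>r s. P p i r s" for p i
    using ex[of i p] by (auto simp: P_def)
  then obtain r s where P: "\<And>p i. P p i (r p i) (s p i)"
    by metis
  have r: "q p j \<le> r p i j \<and> r p i j \<le> q p j + 1" "l (e p (r p i)) i = 0"
    and s: "q p j \<le> s p i j \<and> s p i j \<le> q p j + 1" "l (e p (s p i)) i = 1"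
    if "i < n" "j < n" for p i j
    using P[of p i] that by (auto simp: P_def)
  have inK: "e p (q p) \<in> K" for p
    using q by (intro eK) (simp add: less_imp_le)
  obtain x \<phi> where x: "x \<in> K" "strict_mono \<phi>" "((\<lambda>p. e p (q p)) \<circ> \<phi>) \<longlonglongrightarrow> x"
    using seq_compactE[OF seqK, of "\<lambda>p. e p (q p)"] inK by metis
  \<comment> \<open>Each vertex of a cell is within \<open>1 / Suc p\<close> of its lowest corner in
    every coordinate, so any choice of vertices has the same limit \<open>x\<close>.\<close>
  have near: "(\<lambda>k. e (\<phi> k) (w (\<phi> k))) \<longlonglongrightarrow> x"
    if w: "\<And>p j. j < n \<Longrightarrow> q p j \<le> w p j \<and> w p j \<le> q p j + 1" for w
  proof (rule tendsto_fun_componentwise)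
    fix j
    have lim: "(\<lambda>k. e (\<phi> k) (q (\<phi> k)) j) \<longlonglongrightarrow> x j"
      using continuous_on_tendsto_compose[OF continuous_on_product_coordinates[of j] x(3)]
      by simp
    show "(\<lambda>k. e (\<phi> k) (w (\<phi> k)) j) \<longlonglongrightarrow> x j"
    proof (cases "j < n")
      case True
      have "(\<lambda>k. inverse (real (Suc (\<phi> k)))) \<longlonglongrightarrow> 0"
        using LIMSEQ_subseq_LIMSEQ[OF LIMSEQ_inverse_real_of_nat x(2)] by (simp add: comp_def)
      then have "(\<lambda>k. e (\<phi> k) (q (\<phi> k)) j + inverse (real (Suc (\<phi> k)))) \<longlonglongrightarrow> x j + 0"
        by (intro tendsto_add lim)
      then have up: "(\<lambda>k. e (\<phi> k) (q (\<phi> k)) j + inverse (real (Suc (\<phi> k)))) \<longlonglongrightarrow> x j"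
        by simp
      have bnd: "e p (q p) j \<le> e p (w p) j" "e p (w p) j \<le> e p (q p) j + inverse (real (Suc p))" for p
      proof -
        have "real (q p j) \<le> real (w p j)" "real (w p j) \<le> real (q p j) + 1"
          using w[of j p] True by (auto simp flip: of_nat_Suc)
        then show "e p (q p) j \<le> e p (w p) j" "e p (w p) j \<le> e p (q p) j + inverse (real (Suc p))"
          using True divide_right_mono[of "real (q p j)" "real (w p j)" "real (Suc p)"]
            divide_right_mono[of "real (w p j)" "real (q p j) + 1" "real (Suc p)"]
          by (auto simp: e_def add_divide_distrib inverse_eq_divide simp del: of_nat_Suc)
      qed
      show ?thesis
        by (rule tendsto_sandwich[OF _ _ lim up]) (simp_all only: bnd eventually_True)
    next
      case False
      with lim show ?thesis by (simp add: e_def)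
    qed
  qed
  \<comment> \<open>Since \<open>q p j < Suc p\<close>, the upper vertices \<open>q p j + 1\<close>
    are still grid points.\<close>
  have wK: "e p w \<in> K" if "\<And>j. j < n \<Longrightarrow> q p j \<le> w j \<and> w j \<le> q p j + 1" for p w
    using that q by (intro eK) (metis Suc_eq_plus1 Suc_leI le_trans not_less_eq_eq)
  have "f x i = x i" if i: "i < n" for i
  proof (rule antisym)
    have lims: "(\<lambda>k. e (\<phi> k) (w (\<phi> k)) i) \<longlonglongrightarrow> x i" "(\<lambda>k. f (e (\<phi> k) (w (\<phi> k))) i) \<longlonglongrightarrow> f x i"
      if w: "\<And>p j. j < n \<Longrightarrow> q p j \<le> w p j \<and> w p j \<le> q p j + 1" for w
      using continuous_on_tendsto_compose[OF continuous_on_product_coordinates[of i] near[of w]]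
        continuous_on_tendsto_compose[OF cont[OF i] near[of w] x(1)] w wK
      by auto
    \<comment> \<open>The vertices with label 1 give this inequality in the limit, those with label
      0 the converse.\<close>
    show "f x i \<le> x i"
      using lims[of "\<lambda>p. s p i"] s[OF i] i wK l(5)
      by (intro LIMSEQ_le[of "\<lambda>k. f (e (\<phi> k) (s (\<phi> k) i)) i" _ "\<lambda>k. e (\<phi> k) (s (\<phi> k) i) i"]) auto
    show "x i \<le> f x i"
      using lims[of "\<lambda>p. r p i"] r[OF i] i wK l(4)
      by (intro LIMSEQ_le[of "\<lambda>k. e (\<phi> k) (r (\<phi> k) i) i" _ "\<lambda>k. f (e (\<phi> k) (r (\<phi> k) i)) i"]) auto
  qed
  with x(1) show ?thesis by blast
qed

text \<open>An enumeration of \<open>A\<close> reduces this to \<open>brouwer_coordinates\<close>.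
  Coordinates outside \<open>A\<close> are free in \<open>K\<close>, so a point of the smaller cube
  is extended there by 0.\<close>

lemma brouwer_finite_index:
  fixes f :: "('a \<Rightarrow> real) \<Rightarrow> 'a \<Rightarrow> real"
  defines "K \<equiv> {x. \<forall>a. 0 \<le> x a \<and> x a \<le> 1}"
  assumes "finite A"
    and cont: "\<And>a. a \<in> A \<Longrightarrow> continuous_on K (\<lambda>x. f x a)"
    and maps: "\<And>x a. x \<in> K \<Longrightarrow> a \<in> A \<Longrightarrow> 0 \<le> f x a \<and> f x a \<le> 1"
  shows "\<exists>x\<in>K. \<forall>a\<in>A. f x a = x a"
proof -
  obtain h where h: "bij_betw h {..<card A} A"
    using ex_bij_betw_nat_finite[OF assms(2)] by (auto simp: atLeast0LessThan)
  define g where "g = the_inv_into {..<card A} h"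
  have gh: "g (h i) = i" if "i < card A" for i
    using h that by (simp add: g_def bij_betw_def the_inv_into_f_f)
  have hg: "g a < card A" "h (g a) = a" if "a \<in> A" for a
    using h that bij_betwE[OF bij_betw_the_inv_into[OF h]]
    by (auto simp: g_def f_the_inv_into_f_bij_betw)
  have hA: "h i \<in> A" if "i < card A" for i
    using h that by (auto simp: bij_betw_def)
  let ?L = "{y::nat \<Rightarrow> real. (\<forall>i<card A. 0 \<le> y i \<and> y i \<le> 1) \<and> (\<forall>i\<ge>card A. y i = 0)}"
  define X where "X = (\<lambda>y a. if a \<in> A then y (g a) else (0::real))"
  have XK: "X y \<in> K" if "y \<in> ?L" for y
    using that hg(1) by (auto simp: K_def X_def)
  have contX: "continuous_on ?L X"
  proof (rule continuous_on_coordinatewise_then_product)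
    show "continuous_on ?L (\<lambda>y. X y a)" for a
      by (cases "a \<in> A")
        (auto simp: X_def intro: continuous_on_subset[OF continuous_on_product_coordinates])
  qed
  have "\<exists>y\<in>?L. \<forall>i<card A. f (X y) (h i) = y i"
  proof (rule brouwer_coordinates)
    show "continuous_on ?L (\<lambda>y. f (X y) (h i))" if "i < card A" for i
      by (rule continuous_on_compose2[OF cont[OF hA[OF that]] contX]) (use XK in blast)
    show "0 \<le> f (X y) (h i) \<and> f (X y) (h i) \<le> 1" if "y \<in> ?L" "i < card A" for y i
      by (rule maps[OF XK[OF that(1)] hA[OF that(2)]])
  qed
  then obtain y where y: "y \<in> ?L" "\<And>i. i < card A \<Longrightarrow> f (X y) (h i) = y i"
    by blast
  have "f (X y) a = X y a" if "a \<in> A" for a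
    using y(2)[OF hg(1)[OF that]] hg(2)[OF that] that by (simp add: X_def)
  with XK[OF y(1)] show ?thesis by blast
qed

section \<open>Existence of a Nash equilibrium\<close>

text \<open>Strategies are real weights rather than distributions, so that continuity in
  \<open>x\<close> can be stated.\<close>

definition pure_payoff ::
  "'i set \<Rightarrow> ('i \<Rightarrow> 's set) \<Rightarrow> ('i \<Rightarrow> ('i \<Rightarrow> 's) \<Rightarrow> real) \<Rightarrow> ('i \<Rightarrow> 's \<Rightarrow> real) \<Rightarrow> 'i \<Rightarrow> 's \<Rightarrow> real" where
  "pure_payoff I S U x i a =
     (\<Sum>r\<in>PiE (I - {i}) S. (\<Prod>j\<in>I - {i}. x j (r j)) * U i (r(i := a)))"

lemma pure_payoff_cong:
  assumes "\<And>j a. j \<in> I \<Longrightarrow> a \<in> S j \<Longrightarrow> x j a = y j a"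
  shows "pure_payoff I S U x i a = pure_payoff I S U y i a"
  unfolding pure_payoff_def
  by (intro sum.cong prod.cong arg_cong2[where f = "(*)"] refl) (use assms in auto)

text \<open>Nash's argument: an action in use that pays at most the average \<open>u\<close> has
  excess 0, so its equation forces the total excess \<open>G\<close> to be 0, and with it every
  single excess.\<close>

lemma nash_map_fixed_imp_optimal:
  fixes A :: "'s set" and p v :: "'s \<Rightarrow> real"
  defines "u \<equiv> \<Sum>b\<in>A. p b * v b"
  assumes A: "finite A" and p: "\<And>a. a \<in> A \<Longrightarrow> 0 \<le> p a" "(\<Sum>a\<in>A. p a) = 1"
    and fixed: "\<And>a. a \<in> A \<Longrightarrow> p a = (p a + max 0 (v a - u)) / (1 + (\<Sum>b\<in>A. max 0 (v b - u)))"
    and "a \<in> A"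
  shows "v a \<le> u"
proof -
  define G where "G = (\<Sum>b\<in>A. max 0 (v b - u))"
  have G: "0 \<le> G"
    unfolding G_def by (intro sum_nonneg) auto
  have fixed': "p a * G = max 0 (v a - u)" if "a \<in> A" for a
    using fixed[OF that] G unfolding G_def[symmetric] by (simp add: field_simps)
  \<comment> \<open>The weighted deviations from \<open>u\<close> sum to 0, so the actions in use
    cannot all pay more than \<open>u\<close>.\<close>
  have "\<exists>b\<in>A. 0 < p b \<and> v b \<le> u"
  proof (rule ccontr)
    assume none: "\<not> (\<exists>b\<in>A. 0 < p b \<and> v b \<le> u)"
    have nn: "0 \<le> p b * (v b - u)" if "b \<in> A" for b
      using none that p(1)[OF that] by (cases "p b = 0") (auto intro!: mult_nonneg_nonneg)
    have "(\<Sum>b\<in>A. p b * (v b - u)) = 0"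
      using p(2) by (simp add: right_diff_distrib sum_subtractf u_def flip: sum_distrib_right)
    then have "p b * (v b - u) = 0" if "b \<in> A" for b
      using sum_nonneg_eq_0_iff[OF A, of "\<lambda>b. p b * (v b - u)"] nn that by blast
    then have "p b = 0" if "b \<in> A" for b
      using none that p(1)[OF that] by force
    with p(2) show False by simp
  qed
  then obtain b where b: "b \<in> A" "0 < p b" "v b \<le> u" by blast
  have "G = 0"
    using fixed'[OF b(1)] b by simp
  with fixed'[OF \<open>a \<in> A\<close>] show ?thesis by simp
qed

text \<open>Nash's map \<open>N\<close> is composed with a retraction \<open>R\<close>, so that
  Brouwer's theorem for the cube applies.\<close>

lemma nash_profile_exists:
  fixes S :: "'i \<Rightarrow> 's set"
  assumes I: "finite I" and S: "\<forall>i\<in>I. finite (S i)" "\<forall>i\<in>I. S i \<noteq> {}"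
  shows "\<exists>x. \<forall>i\<in>I. (\<forall>a\<in>S i. 0 \<le> x i a) \<and> (\<Sum>a\<in>S i. x i a) = 1 \<and>
    (\<forall>a\<in>S i. pure_payoff I S U x i a \<le> (\<Sum>b\<in>S i. x i b * pure_payoff I S U x i b))"
proof -
  let ?A = "Sigma I S"
  let ?K = "{x :: 'i \<times> 's \<Rightarrow> real. \<forall>a. 0 \<le> x a \<and> x a \<le> 1}"
  \<comment> \<open>\<open>R\<close> retracts the cube onto the product of simplices.\<close>
  define R where "R = (\<lambda>(x :: 'i \<times> 's \<Rightarrow> real) i a.
    (x (i, a) + max 0 (1 - (\<Sum>b\<in>S i. x (i, b))) / card (S i)) / max 1 (\<Sum>b\<in>S i. x (i, b)))"
  define V where "V = (\<lambda>x. pure_payoff I S U (R x))"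
  define u where "u = (\<lambda>x i. \<Sum>b\<in>S i. R x i b * V x i b)"
  define N where "N = (\<lambda>x i a. (R x i a + max 0 (V x i a - u x i)) / (1 + (\<Sum>b\<in>S i. max 0 (V x i b - u x i))))"
  have card: "0 < card (S i)" if "i \<in> I" for i
    using S that by (simp add: card_gt_0_iff)
  have R_nn: "0 \<le> R x i a" if "x \<in> ?K" for x i a
    using that by (auto simp: R_def intro!: divide_nonneg_nonneg add_nonneg_nonneg)
  \<comment> \<open>If the coordinates of player \<open>i\<close> sum to less than 1, the missing
    mass is spread evenly over \<open>S i\<close>; if they sum to more, they are divided by their
    sum.\<close>
  have R_sum: "(\<Sum>a\<in>S i. R x i a) = 1" if "i \<in> I" for x i
    using card[OF that]
    by (simp add: R_def sum.distrib flip: sum_divide_distrib) (simp add: max_def)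
  have G_nn: "0 \<le> (\<Sum>b\<in>S i. max 0 (V x i b - u x i))" for x i
    by (intro sum_nonneg) auto
  have N_nn: "0 \<le> N x i a" if "x \<in> ?K" for x i a
    using R_nn[OF that] G_nn by (simp add: N_def)
  have N_sum: "(\<Sum>a\<in>S i. N x i a) = 1" if "i \<in> I" for x i
    using R_sum[OF that, of x] G_nn[of x i]
    by (simp add: N_def sum.distrib flip: sum_divide_distrib)
  have N_le: "N x i a \<le> 1" if "x \<in> ?K" "i \<in> I" "a \<in> S i" for x i a
    using member_le_sum[of a "S i" "N x i"] N_nn[OF that(1)] N_sum[OF that(2)] S(1) that by auto
  have contx: "continuous_on ?K (\<lambda>x. x a)" for a
    by (rule continuous_on_subset[OF continuous_on_product_coordinates]) simp
  have contR: "continuous_on ?K (\<lambda>x. R x i a)" if "i \<in> I" for i a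
    unfolding R_def using card[OF that] by (intro continuous_intros contx) (auto simp: max_def)
  have contV: "continuous_on ?K (\<lambda>x. V x i a)" for i a
    unfolding V_def pure_payoff_def by (intro continuous_intros contR) auto
  have contu: "continuous_on ?K (\<lambda>x. u x i)" if "i \<in> I" for i
    unfolding u_def by (intro continuous_intros contR[OF that] contV)
  have contN: "continuous_on ?K (\<lambda>x. N x i a)" if "i \<in> I" for i a
  proof -
    have "1 + (\<Sum>b\<in>S i. max 0 (V x i b - u x i)) \<noteq> 0" for x
      using G_nn[of x i] by linarith
    then show ?thesis
      unfolding N_def by (intro continuous_intros contR[OF that] contV contu[OF that]) auto
  qed
  have "\<exists>x\<in>?K. \<forall>a\<in>?A. (\<lambda>x (i, a). N x i a) x a = x a"
    by (rule brouwer_finite_index) (use I S contN N_nn N_le in auto)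
  then obtain x where x: "x \<in> ?K" "\<And>i a. i \<in> I \<Longrightarrow> a \<in> S i \<Longrightarrow> N x i a = x (i, a)"
    by auto
  \<comment> \<open>Values of \<open>N\<close> sum to 1 for each player, hence so does the fixed
    point, and \<open>R\<close> leaves it unchanged.\<close>
  have "(\<Sum>a\<in>S i. x (i, a)) = 1" if "i \<in> I" for i
    using N_sum[OF that, of x] x(2)[OF that] by simp
  then have Rx: "R x i a = x (i, a)" if "i \<in> I" for i a
    using that by (simp add: R_def)
  have "V x i a \<le> u x i" if "i \<in> I" "a \<in> S i" for i a
    unfolding u_def
  proof (rule nash_map_fixed_imp_optimal)
    show "R x i b = (R x i b + max 0 (V x i b - (\<Sum>b\<in>S i. R x i b * V x i b)))
      / (1 + (\<Sum>b\<in>S i. max 0 (V x i b - (\<Sum>b\<in>S i. R x i b * V x i b))))" if "b \<in> S i" for b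
      using x(2)[OF \<open>i \<in> I\<close> that] Rx[OF \<open>i \<in> I\<close>] by (simp add: N_def u_def)
  qed (use that S R_nn[OF x(1)] R_sum in auto)
  then show ?thesis
    using R_nn[OF x(1)] R_sum by (intro exI[of _ "R x"]) (auto simp: V_def u_def)
qed

section \<open>Sums over profiles and product distributions\<close>

lemma sum_PiE_remove:
  assumes "i \<in> I"
  shows "(\<Sum>s\<in>PiE I S. g s) = (\<Sum>a\<in>S i. \<Sum>r\<in>PiE (I - {i}) S. g (r(i := a)))"
proof -
  have "PiE I S = (\<lambda>(a, r). r(i := a)) ` (S i \<times> PiE (I - {i}) S)"
    using assms PiE_insert_eq[of i "I - {i}" S] by (simp add: insert_absorb)
  moreover have "inj_on (\<lambda>(a, r). r(i := a)) (S i \<times> PiE (I - {i}) S)"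
    by (rule inj_combinator) simp
  ultimately show ?thesis
    by (simp add: sum.reindex sum.cartesian_product case_prod_unfold)
qed

lemma fun_upd_in_PiE:
  "i \<in> I \<Longrightarrow> r \<in> PiE (I - {i}) S \<Longrightarrow> a \<in> S i \<Longrightarrow> r(i := a) \<in> PiE I S"
  using PiE_fun_upd[of a S i r "I - {i}"] by (simp add: insert_absorb)

lemma prod_fun_upd_remove:
  assumes "finite I" "i \<in> I"
  shows "(\<Prod>j\<in>I. x j ((r(i := a)) j)) = x i a * (\<Prod>j\<in>I - {i}. x j (r j))"
proof -
  have "(\<Prod>j\<in>I - {i}. x j ((r(i := a)) j)) = (\<Prod>j\<in>I - {i}. x j (r j))"
    by (intro prod.cong) auto
  then show ?thesis
    using prod.remove[OF assms, of "\<lambda>j. x j ((r(i := a)) j)"] by simp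
qed

lemma pmf_of_weights:
  fixes w :: "'a \<Rightarrow> real"
  assumes A: "finite A" and w: "\<And>a. a \<in> A \<Longrightarrow> 0 \<le> w a" "(\<Sum>a\<in>A. w a) = 1"
  shows "\<exists>p. set_pmf p \<subseteq> A \<and> (\<forall>a\<in>A. pmf p a = w a)"
proof -
  let ?w = "\<lambda>a. if a \<in> A then w a else 0"
  have nonneg: "0 \<le> ?w a" for a
    using w by simp
  have "(\<integral>\<^sup>+a. ennreal (?w a) \<partial>count_space UNIV) = (\<Sum>a\<in>A. ennreal (?w a))"
    by (rule nn_integral_count_space'[OF A]) auto
  also have "\<dots> = 1"
    using w by (simp add: sum_ennreal)
  finally have one: "(\<integral>\<^sup>+a. ennreal (?w a) \<partial>count_space UNIV) = 1" .
  show ?thesis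
  proof (intro exI conjI ballI)
    show "set_pmf (embed_pmf ?w) \<subseteq> A"
      unfolding set_embed_pmf[OF nonneg one] by auto
    show "pmf (embed_pmf ?w) a = w a" if "a \<in> A" for a
      unfolding pmf_embed_pmf[OF nonneg one] using that by simp
  qed
qed

lemma pmf_product_dist:
  assumes "finite I" "s \<in> PiE I S"
  shows "pmf (product_dist I \<sigma>) s = (\<Prod>j\<in>I. pmf (\<sigma> j) (s j))"
  using assms by (simp add: product_dist_def pmf_Pi PiE_def extensional_def)

text \<open>The payoff is linear in the player's own strategy, and \<open>pure_payoff\<close> reads
  only the strategies of the opponents, so the original \<open>\<sigma>\<close> may stand on the
  right.\<close>

lemma mixed_payoff_fun_upd:
  assumes "finite I" "\<forall>i\<in>I. finite (S i)" "mixed_profile I S \<sigma>" "i \<in> I" "set_pmf \<tau> \<subseteq> S i"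
  shows "mixed_payoff I U i (\<sigma>(i := \<tau>)) =
    (\<Sum>a\<in>S i. pmf \<tau> a * pure_payoff I S U (\<lambda>j. pmf (\<sigma> j)) i a)"
proof -
  have "mixed_profile I S (\<sigma>(i := \<tau>))"
    using assms(3,5) by (simp add: mixed_profile_def)
  then have "mixed_payoff I U i (\<sigma>(i := \<tau>)) =
      (\<Sum>s\<in>PiE I S. (\<Prod>j\<in>I. pmf ((\<sigma>(i := \<tau>)) j) (s j)) * U i s)"
    using assms(1,2) by (intro mixed_payoff_eq_sum) auto
  also have "\<dots> = (\<Sum>a\<in>S i. \<Sum>r\<in>PiE (I - {i}) S.
      (\<Prod>j\<in>I. pmf ((\<sigma>(i := \<tau>)) j) ((r(i := a)) j)) * U i (r(i := a)))"
    by (rule sum_PiE_remove[OF assms(4)])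
  also have "\<dots> = (\<Sum>a\<in>S i. \<Sum>r\<in>PiE (I - {i}) S.
      pmf \<tau> a * ((\<Prod>j\<in>I - {i}. pmf (\<sigma> j) (r j)) * U i (r(i := a))))"
    by (intro sum.cong refl, subst prod_fun_upd_remove[OF assms(1,4)]) (simp add: mult.assoc)
  finally show ?thesis
    by (simp add: pure_payoff_def sum_distrib_left)
qed

section \<open>Incentive constraints and their dual multipliers\<close>

text \<open>The left side of the equilibrium inequality for arbitrary real weights \<open>m\<close>,
  which makes it a linear functional of \<open>m\<close>.\<close>

definition incentive ::
  "'i set \<Rightarrow> ('i \<Rightarrow> 's set) \<Rightarrow> ('i \<Rightarrow> ('i \<Rightarrow> 's) \<Rightarrow> real) \<Rightarrow> (('i \<Rightarrow> 's) \<Rightarrow> real) \<Rightarrow> 'i \<Rightarrow> 's \<Rightarrow> 's \<Rightarrow> real" where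
  "incentive I S U m i s t =
     (\<Sum>r\<in>PiE (I - {i}) S. m (r(i := s)) * (U i (r(i := s)) - U i (r(i := t))))"

lemma correlated_equilibrium_incentive:
  "correlated_equilibrium I S U \<mu> \<longleftrightarrow> set_pmf \<mu> \<subseteq> PiE I S \<and>
     (\<forall>i\<in>I. \<forall>s\<in>S i. \<forall>t\<in>S i. 0 \<le> incentive I S U (pmf \<mu>) i s t)"
  by (simp add: correlated_equilibrium_def incentive_def)

lemma incentive_scale:
  assumes "i \<in> I" "s \<in> S i" "\<And>p. p \<in> PiE I S \<Longrightarrow> m p = c * m' p"
  shows "incentive I S U m i s t = c * incentive I S U m' i s t"
  unfolding incentive_def sum_distrib_left
  by (intro sum.cong refl) (simp add: assms fun_upd_in_PiE)

text \<open>The factor \<open>x i s\<close> is common to all opponent profiles. This serves both for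
  the Nash equilibrium and for the product of stationary distributions.\<close>

lemma incentive_product:
  assumes "finite I" "i \<in> I" "s \<in> S i" "\<And>p. p \<in> PiE I S \<Longrightarrow> m p = (\<Prod>j\<in>I. x j (p j))"
  shows "incentive I S U m i s t = x i s * (pure_payoff I S U x i s - pure_payoff I S U x i t)"
proof -
  have "incentive I S U m i s t = (\<Sum>r\<in>PiE (I - {i}) S.
      x i s * (\<Prod>j\<in>I - {i}. x j (r j)) * (U i (r(i := s)) - U i (r(i := t))))"
    unfolding incentive_def
  proof (intro sum.cong refl)
    fix r assume "r \<in> PiE (I - {i}) S"
    then have "m (r(i := s)) = (\<Prod>j\<in>I. x j ((r(i := s)) j))"
      using assms by (simp add: fun_upd_in_PiE)
    then show "m (r(i := s)) * (U i (r(i := s)) - U i (r(i := t))) =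
        x i s * (\<Prod>j\<in>I - {i}. x j (r j)) * (U i (r(i := s)) - U i (r(i := t)))"
      by (simp only: prod_fun_upd_remove[OF assms(1,2)])
  qed
  then show ?thesis
    by (simp add: pure_payoff_def algebra_simps sum_subtractf sum_distrib_left)
qed

lemma linear_functional_incentive:
  "linear_functional (\<lambda>m. incentive I S U m i s t)"
  unfolding linear_functional_def incentive_def
  by (simp add: distrib_right sum.distrib sum_distrib_left mult.assoc)

text \<open>The terms \<open>p b * (u - v b)\<close> are nonnegative and sum to 0, so each is 0:
  actions in use earn the average.\<close>

lemma nash_profile_payoff_eq:
  fixes p v :: "'s \<Rightarrow> real"
  assumes A: "finite A" and p: "\<And>a. a \<in> A \<Longrightarrow> 0 \<le> p a" "(\<Sum>a\<in>A. p a) = 1"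
    and le: "\<And>a. a \<in> A \<Longrightarrow> v a \<le> (\<Sum>b\<in>A. p b * v b)" and "a \<in> A"
  shows "p a * v a = p a * (\<Sum>b\<in>A. p b * v b)"
proof -
  define u where "u = (\<Sum>b\<in>A. p b * v b)"
  have nn: "0 \<le> p b * (u - v b)" if "b \<in> A" for b
    using le[OF that] p(1)[OF that] by (simp add: u_def)
  have "(\<Sum>b\<in>A. p b * (u - v b)) = 0"
    using p(2) by (simp add: right_diff_distrib sum_subtractf flip: sum_distrib_right u_def)
  then have "p a * (u - v a) = 0"
    using sum_nonneg_eq_0_iff[OF A, of "\<lambda>b. p b * (u - v b)"] nn \<open>a \<in> A\<close> by blast
  then show ?thesis
    by (auto simp: u_def algebra_simps)
qed

text \<open>Any nonzero \<open>m\<close> in the cone of the constraints becomes a correlated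
  equilibrium when normalized, so by uniqueness the cone consists, on \<open>PiE I S\<close>, of
  multiples of \<open>pmf \<mu>\<close>. A constraint tight at \<open>\<mu>\<close> thus vanishes on
  the whole cone, as \<open>complementary_multipliers\<close> requires.\<close>

lemma unique_correlated_equilibrium_multipliers:
  fixes S :: "'i \<Rightarrow> 's set"
  assumes I: "finite I" and S: "\<forall>i\<in>I. finite (S i)"
    and unique: "\<forall>\<nu>. correlated_equilibrium I S U \<nu> \<longrightarrow> \<nu> = \<mu>"
  shows "\<exists>\<alpha> \<beta>.
    (\<forall>i\<in>I. \<forall>s\<in>S i. \<forall>t\<in>S i. 0 \<le> \<alpha> i s t \<and>
      (incentive I S U (pmf \<mu>) i s t = 0 \<longrightarrow> 0 < \<alpha> i s t)) \<and>
    (\<forall>p\<in>PiE I S. 0 \<le> \<beta> p \<and> (pmf \<mu> p = 0 \<longrightarrow> (0::real) < \<beta> p)) \<and>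
    (\<forall>m. (\<Sum>p\<in>PiE I S. \<beta> p * m p) +
      (\<Sum>i\<in>I. \<Sum>s\<in>S i. \<Sum>t\<in>S i. \<alpha> i s t * incentive I S U m i s t) = 0)"
proof -
  let ?P = "PiE I S" and ?Q = "Sigma I (\<lambda>i. S i \<times> S i)"
  have finP: "finite ?P" and finQ: "finite ?Q"
    using I S by (auto intro: finite_PiE)
  define f where "f = (\<lambda>k m. case k of Inl p \<Rightarrow> m p | Inr (i, s, t) \<Rightarrow> incentive I S U m i s t)"
  have f: "f (Inl p) m = m p" "f (Inr (i, s, t)) m = incentive I S U m i s t" for p i s t m
    by (simp_all add: f_def)
  \<comment> \<open>Left indices are positivity constraints, right indices incentive
    constraints.\<close>
  define K where "K = ?P <+> ?Q"
  have "\<exists>c. (\<forall>k\<in>K. 0 \<le> c k) \<and> (\<forall>k\<in>{k \<in> K. f k (pmf \<mu>) = 0}. 0 < c k) \<and>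
      (\<forall>m. (\<Sum>k\<in>K. c k * f k m) = 0)"
  proof (rule complementary_multipliers)
    show "finite K"
      using finP finQ by (simp add: K_def)
    show "{k \<in> K. f k (pmf \<mu>) = 0} \<subseteq> K" by auto
    show "linear_functional (f k)" for k
    proof (cases k)
      case (Inl p)
      then show ?thesis by (simp add: f_def linear_functional_def)
    next
      case (Inr q)
      then show ?thesis
        by (cases q) (simp add: f_def linear_functional_incentive)
    qed
    fix m k assume m: "\<And>k. k \<in> K \<Longrightarrow> 0 \<le> f k m" and k: "k \<in> {k \<in> K. f k (pmf \<mu>) = 0}"
    have m_nn: "0 \<le> m p" if "p \<in> ?P" for p
      using m[of "Inl p"] that unfolding K_def f(1) by blast
    have m_inc: "0 \<le> incentive I S U m i s t" if "i \<in> I" "s \<in> S i" "t \<in> S i" for i s t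
      using m[of "Inr (i, s, t)"] that unfolding K_def f(2) by blast
    define X where "X = (\<Sum>p\<in>?P. m p)"
    have X: "0 \<le> X"
      unfolding X_def using m_nn by (rule sum_nonneg)
    have mX: "m p = X * pmf \<mu> p" if p: "p \<in> ?P" for p
    proof (cases "X = 0")
      case True
      then show ?thesis
        using p m_nn sum_nonneg_eq_0_iff[OF finP, of m] by (simp add: X_def)
    next
      case False
      obtain \<nu> where \<nu>: "set_pmf \<nu> \<subseteq> ?P" "\<And>p. p \<in> ?P \<Longrightarrow> pmf \<nu> p = m p / X"
        using pmf_of_weights[OF finP, of "\<lambda>p. m p / X"] m_nn X False
        by (auto simp: X_def simp flip: sum_divide_distrib)
      have "0 \<le> incentive I S U (pmf \<nu>) i s t" if "i \<in> I" "s \<in> S i" "t \<in> S i" for i s t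
        using incentive_scale[of i I s S "pmf \<nu>" "1 / X" m U t] \<nu>(2) m_inc[OF that] that X by simp
      with \<nu>(1) have "\<nu> = \<mu>"
        by (intro unique[rule_format]) (simp add: correlated_equilibrium_incentive)
      then show ?thesis
        using \<nu>(2)[OF p] False by (simp add: field_simps)
    qed
    show "f k m = 0"
    proof (cases k)
      case (Inl p)
      then show ?thesis
        using k mX[of p] by (auto simp: f K_def)
    next
      case (Inr q)
      obtain i s t where q: "q = (i, s, t)" by (cases q)
      then have "i \<in> I" "s \<in> S i" "incentive I S U (pmf \<mu>) i s t = 0"
        using k Inr by (auto simp: f K_def)
      with incentive_scale[of i I s S m X "pmf \<mu>" U t] mX show ?thesis
        by (simp add: f Inr q)
    qed
  qed
  then obtain c where c: "\<And>k. k \<in> K \<Longrightarrow> 0 \<le> c k" "\<And>k. k \<in> K \<Longrightarrow> f k (pmf \<mu>) = 0 \<Longrightarrow> 0 < c k"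
    "\<And>m. (\<Sum>k\<in>K. c k * f k m) = 0"
    by blast
  have eq: "(\<Sum>p\<in>?P. c (Inl p) * m p) +
      (\<Sum>i\<in>I. \<Sum>s\<in>S i. \<Sum>t\<in>S i. c (Inr (i, s, t)) * incentive I S U m i s t) = 0" for m
  proof -
    have "(\<Sum>k\<in>K. c k * f k m) = (\<Sum>p\<in>?P. c (Inl p) * m p) +
        (\<Sum>(i, s, t)\<in>?Q. c (Inr (i, s, t)) * incentive I S U m i s t)"
      unfolding K_def sum.Plus[OF finP finQ] by (simp add: f_def case_prod_unfold)
    also have "(\<Sum>(i, s, t)\<in>?Q. c (Inr (i, s, t)) * incentive I S U m i s t) =
        (\<Sum>i\<in>I. \<Sum>(s, t)\<in>S i \<times> S i. c (Inr (i, s, t)) * incentive I S U m i s t)"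
      using I S by (subst sum.Sigma) auto
    also have "\<dots> = (\<Sum>i\<in>I. \<Sum>s\<in>S i. \<Sum>t\<in>S i. c (Inr (i, s, t)) * incentive I S U m i s t)"
      by (simp add: sum.cartesian_product)
    finally show ?thesis
      by (simp add: c(3))
  qed
  have "0 \<le> c (Inl p) \<and> (pmf \<mu> p = 0 \<longrightarrow> 0 < c (Inl p))" if "p \<in> ?P" for p
    using c(1,2)[of "Inl p"] that unfolding K_def f(1) by blast
  moreover have "0 \<le> c (Inr (i, s, t)) \<and> (incentive I S U (pmf \<mu>) i s t = 0 \<longrightarrow> 0 < c (Inr (i, s, t)))"
    if "i \<in> I" "s \<in> S i" "t \<in> S i" for i s t
    using c(1,2)[of "Inr (i, s, t)"] that unfolding K_def f(2) by blast
  ultimately show ?thesis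
    by (intro exI[of _ "\<lambda>i s t. c (Inr (i, s, t))"] exI[of _ "\<lambda>p. c (Inl p)"] conjI ballI allI eq) simp_all
qed

section \<open>Stationary products and best responses\<close>

text \<open>Collecting terms, each \<open>v t\<close> is multiplied by outflow minus inflow at
  \<open>t\<close>, which is 0.\<close>

lemma stationary_gain_eq_0:
  fixes v \<tau> :: "'a \<Rightarrow> real"
  assumes "\<And>t. t \<in> A \<Longrightarrow> (\<Sum>a\<in>A. \<tau> a * \<alpha> a t) = \<tau> t * (\<Sum>b\<in>A. \<alpha> t b)"
  shows "(\<Sum>s\<in>A. \<Sum>t\<in>A. \<alpha> s t * (\<tau> s * (v s - v t))) = 0"
proof -
  have "(\<Sum>s\<in>A. \<Sum>t\<in>A. \<alpha> s t * (\<tau> s * (v s - v t))) =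
      (\<Sum>s\<in>A. v s * (\<tau> s * (\<Sum>t\<in>A. \<alpha> s t))) - (\<Sum>s\<in>A. \<Sum>t\<in>A. v t * (\<tau> s * \<alpha> s t))"
    by (simp add: algebra_simps sum_subtractf sum_distrib_left)
  also have "(\<Sum>s\<in>A. \<Sum>t\<in>A. v t * (\<tau> s * \<alpha> s t)) = (\<Sum>t\<in>A. v t * (\<Sum>s\<in>A. \<tau> s * \<alpha> s t))"
    by (subst sum.swap) (simp add: sum_distrib_left)
  also have "\<dots> = (\<Sum>t\<in>A. v t * (\<tau> t * (\<Sum>b\<in>A. \<alpha> t b)))"
    using assms by (intro sum.cong) auto
  finally show ?thesis by simp
qed

lemma unique_correlated_equilibrium_best_response_in_support:
  fixes S :: "'i \<Rightarrow> 's set" and \<mu> :: "('i \<Rightarrow> 's) pmf"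
  assumes I: "finite I" and S: "\<forall>i\<in>I. finite (S i)" "\<forall>i\<in>I. S i \<noteq> {}"
    and unique: "\<forall>\<nu>. correlated_equilibrium I S U \<nu> \<longrightarrow> \<nu> = \<mu>"
    and k: "k \<in> I" and t: "t \<in> S k"
    and tight: "\<forall>s\<in>S k. incentive I S U (pmf \<mu>) k s t = 0"
  shows "\<exists>p\<in>PiE I S. p k = t \<and> pmf \<mu> p > 0"
proof (rule ccontr)
  assume contr: "\<not> (\<exists>p\<in>PiE I S. p k = t \<and> pmf \<mu> p > 0)"
  obtain \<alpha> \<beta> where
    \<alpha>': "\<forall>i\<in>I. \<forall>s\<in>S i. \<forall>t\<in>S i. 0 \<le> \<alpha> i s t \<and>
      (incentive I S U (pmf \<mu>) i s t = 0 \<longrightarrow> 0 < \<alpha> i s t)" and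
    \<beta>': "\<forall>p\<in>PiE I S. 0 \<le> \<beta> p \<and> (pmf \<mu> p = 0 \<longrightarrow> (0::real) < \<beta> p)" and
    dual: "\<forall>m. (\<Sum>p\<in>PiE I S. \<beta> p * m p) +
      (\<Sum>i\<in>I. \<Sum>s\<in>S i. \<Sum>t\<in>S i. \<alpha> i s t * incentive I S U m i s t) = 0"
    using unique_correlated_equilibrium_multipliers[OF I S(1) unique]
    by (elim exE conjE) (rule that)
  have \<alpha>: "0 \<le> \<alpha> i s t" "incentive I S U (pmf \<mu>) i s t = 0 \<Longrightarrow> 0 < \<alpha> i s t"
    if "i \<in> I" "s \<in> S i" "t \<in> S i" for i s t
    using \<alpha>' that by auto
  have \<beta>: "0 \<le> \<beta> p" "pmf \<mu> p = 0 \<Longrightarrow> 0 < \<beta> p" if "p \<in> PiE I S" for p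
    using \<beta>' that by auto
  have "\<exists>\<tau>. i \<in> I \<longrightarrow> (\<forall>a\<in>S i. 0 \<le> \<tau> a) \<and> (\<Sum>a\<in>S i. \<tau> a) = 1 \<and>
    (\<forall>t\<in>S i. (\<Sum>a\<in>S i. \<tau> a * \<alpha> i a t) = \<tau> t * (\<Sum>b\<in>S i. \<alpha> i t b))" for i
    using stationary_distribution_exists[of "S i" "\<alpha> i"] S \<alpha>(1) by blast
  then obtain \<tau> where \<tau>: "\<And>i a. i \<in> I \<Longrightarrow> a \<in> S i \<Longrightarrow> 0 \<le> \<tau> i a" "\<And>i. i \<in> I \<Longrightarrow> (\<Sum>a\<in>S i. \<tau> i a) = 1"
    and stat: "\<And>i t. i \<in> I \<Longrightarrow> t \<in> S i \<Longrightarrow>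
      (\<Sum>a\<in>S i. \<tau> i a * \<alpha> i a t) = \<tau> i t * (\<Sum>b\<in>S i. \<alpha> i t b)"
    by metis
  have ex_pos: "\<exists>a\<in>S i. 0 < \<tau> i a" if "i \<in> I" for i
  proof (rule ccontr)
    assume "\<not> ?thesis"
    then have "(\<Sum>a\<in>S i. \<tau> i a) \<le> 0"
      by (intro sum_nonpos) (auto simp: not_less)
    with \<tau>(2)[OF that] show False by simp
  qed
  \<comment> \<open>Some \<open>a\<close> has positive mass, and by \<open>tight\<close> its rate
    into \<open>t\<close> is positive. Stationarity then excludes mass 0 at
    \<open>t\<close>.\<close>
  have t_pos: "0 < \<tau> k t"
  proof (rule ccontr)
    assume "\<not> 0 < \<tau> k t"
    then have "\<tau> k t = 0"
      using \<tau>(1)[OF k t] by simp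
    then have zero: "(\<Sum>a\<in>S k. \<tau> k a * \<alpha> k a t) = 0"
      using stat[OF k t] by simp
    obtain a where a: "a \<in> S k" "0 < \<tau> k a"
      using ex_pos[OF k] by blast
    have "0 < \<tau> k a * \<alpha> k a t"
      using a \<alpha>(2)[OF k a(1) t bspec[OF tight a(1)]] by simp
    also have "\<dots> \<le> (\<Sum>a\<in>S k. \<tau> k a * \<alpha> k a t)"
      using a k t \<tau>(1) \<alpha>(1) S(1) by (intro member_le_sum) auto
    finally show False
      using zero by simp
  qed
  define b where "b = (\<lambda>i. SOME a. a \<in> S i \<and> 0 < \<tau> i a)"
  have b: "b i \<in> S i" "0 < \<tau> i (b i)" if "i \<in> I" for i
    using someI_ex[of "\<lambda>a. a \<in> S i \<and> 0 < \<tau> i a"] ex_pos[OF that] by (auto simp: b_def)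
  \<comment> \<open>A profile in the support of the product of the \<open>\<tau> i\<close> in which
    \<open>k\<close> plays \<open>t\<close>; \<open>restrict\<close> makes it extensional.\<close>
  define p where "p = restrict (b(k := t)) I"
  have p: "p \<in> PiE I S" "p k = t" "\<And>i. i \<in> I \<Longrightarrow> 0 < \<tau> i (p i)"
    using b k t t_pos by (auto simp: p_def)
  \<comment> \<open>The test weights for \<open>dual\<close>: their incentive terms cancel, so the
    nonnegative terms \<open>\<beta> q * m q\<close> sum to 0.\<close>
  define m where "m = (\<lambda>p. \<Prod>i\<in>I. \<tau> i (p i))"
  have "(\<Sum>s\<in>S i. \<Sum>t\<in>S i. \<alpha> i s t * incentive I S U m i s t) = 0" if "i \<in> I" for i
  proof -
    let ?v = "pure_payoff I S U \<tau> i"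
    have "(\<Sum>s\<in>S i. \<Sum>t\<in>S i. \<alpha> i s t * incentive I S U m i s t) =
        (\<Sum>s\<in>S i. \<Sum>t\<in>S i. \<alpha> i s t * (\<tau> i s * (?v s - ?v t)))"
    proof (intro sum.cong refl)
      fix s t assume "s \<in> S i"
      then have "incentive I S U m i s t = \<tau> i s * (?v s - ?v t)"
        by (rule incentive_product[OF I that]) (simp add: m_def)
      then show "\<alpha> i s t * incentive I S U m i s t = \<alpha> i s t * (\<tau> i s * (?v s - ?v t))"
        by simp
    qed
    also have "\<dots> = 0"
      by (rule stationary_gain_eq_0) (rule stat[OF that])
    finally show ?thesis .
  qed
  with spec[OF dual, of m] have "(\<Sum>p\<in>PiE I S. \<beta> p * m p) = 0"
    by simp
  moreover have "0 \<le> \<beta> q * m q" if "q \<in> PiE I S" for q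
    unfolding m_def using that \<tau>(1) \<beta>(1)
    by (intro mult_nonneg_nonneg prod_nonneg) (auto simp: PiE_iff)
  ultimately have "\<beta> p * m p = 0"
    using p(1) sum_nonneg_eq_0_iff[of "PiE I S" "\<lambda>p. \<beta> p * m p"] I S(1)
    by (simp add: finite_PiE)
  moreover have "0 < m p"
    unfolding m_def using p(3) by (rule prod_pos)
  moreover have "pmf \<mu> p = 0"
    using contr p(1,2) pmf_nonneg[of \<mu> p] by (metis less_eq_real_def)
  then have "0 < \<beta> p"
    by (rule \<beta>(2)[OF p(1)])
  ultimately show False by simp
qed

section \<open>From uniqueness to quasi-strictness\<close>

theorem unique_correlated_equilibrium_quasi_strict:
  fixes S :: "'i \<Rightarrow> 's set" and \<mu> :: "('i \<Rightarrow> 's) pmf"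
  assumes I: "finite I" and S: "\<forall>i\<in>I. finite (S i)" "\<forall>i\<in>I. S i \<noteq> {}"
    and unique: "\<forall>\<nu>. correlated_equilibrium I S U \<nu> \<longrightarrow> \<nu> = \<mu>"
  shows "\<exists>\<sigma>. \<mu> = product_dist I \<sigma> \<and> quasi_strict_nash_equilibrium I S U \<sigma>"
proof -
  obtain x where nash: "\<forall>i\<in>I. (\<forall>a\<in>S i. 0 \<le> x i a) \<and> (\<Sum>a\<in>S i. x i a) = 1 \<and>
    (\<forall>a\<in>S i. pure_payoff I S U x i a \<le> (\<Sum>b\<in>S i. x i b * pure_payoff I S U x i b))"
    using nash_profile_exists[OF I S, of U] ..
  then have x_sum: "(\<Sum>a\<in>S i. x i a) = 1" if "i \<in> I" for i
    using that by blast
  have x_nn: "0 \<le> x i a"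
    and x_opt: "pure_payoff I S U x i a \<le> (\<Sum>b\<in>S i. x i b * pure_payoff I S U x i b)"
    if "i \<in> I" "a \<in> S i" for i a
    using nash that by auto
  have "\<exists>p. i \<in> I \<longrightarrow> set_pmf p \<subseteq> S i \<and> (\<forall>a\<in>S i. pmf p a = x i a)" for i
  proof (cases "i \<in> I")
    case True
    show ?thesis
      using pmf_of_weights[OF bspec[OF S(1) True] x_nn[OF True] x_sum[OF True]] by blast
  qed simp
  then obtain \<sigma> where \<sigma>: "\<And>i. i \<in> I \<Longrightarrow> set_pmf (\<sigma> i) \<subseteq> S i"
    "\<And>i a. i \<in> I \<Longrightarrow> a \<in> S i \<Longrightarrow> pmf (\<sigma> i) a = x i a"
    by metis
  define V where "V = pure_payoff I S U (\<lambda>j. pmf (\<sigma> j))"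
  have V: "V i a = pure_payoff I S U x i a" for i a
    unfolding V_def using \<sigma>(2) by (rule pure_payoff_cong)
  define u where "u = (\<lambda>i. \<Sum>b\<in>S i. pmf (\<sigma> i) b * V i b)"
  have sum_\<sigma>: "(\<Sum>a\<in>S i. pmf (\<sigma> i) a) = 1" if "i \<in> I" for i
    using x_sum[OF that] \<sigma>(2)[OF that] by simp
  have V_le: "V i a \<le> u i" if "i \<in> I" "a \<in> S i" for i a
    using x_opt[OF that] \<sigma>(2)[OF that(1)] by (simp add: V u_def)
  have \<sigma>V: "pmf (\<sigma> i) a * V i a = pmf (\<sigma> i) a * u i" if "i \<in> I" "a \<in> S i" for i a
    unfolding u_def
    by (rule nash_profile_payoff_eq) (use that S(1) sum_\<sigma> V_le in \<open>auto simp: u_def\<close>)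
  have profile: "mixed_profile I S \<sigma>"
    using \<sigma>(1) by (simp add: mixed_profile_def)
  have inc: "incentive I S U (pmf (product_dist I \<sigma>)) i s t = pmf (\<sigma> i) s * (V i s - V i t)"
    if "i \<in> I" "s \<in> S i" for i s t
    unfolding V_def using that
    by (intro incentive_product[where x = "\<lambda>j. pmf (\<sigma> j)"]) (auto intro: pmf_product_dist I)
  \<comment> \<open>If \<open>s\<close> is in use, it earns \<open>u i\<close>, which no
    \<open>t\<close> exceeds.\<close>
  have inc_nn: "0 \<le> pmf (\<sigma> i) s * (V i s - V i t)" if "i \<in> I" "s \<in> S i" "t \<in> S i" for i s t
    using \<sigma>V[OF that(1,2)] V_le[OF that(1,3)]
    by (cases "pmf (\<sigma> i) s = 0") auto
  have "correlated_equilibrium I S U (product_dist I \<sigma>)"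
    using set_pmf_product_dist[OF I profile] inc_nn
    by (auto simp: correlated_equilibrium_incentive inc)
  then have \<mu>: "product_dist I \<sigma> = \<mu>"
    by (rule unique[rule_format])
  have payoff: "mixed_payoff I U i (\<sigma>(i := \<tau>)) = (\<Sum>a\<in>S i. pmf \<tau> a * V i a)"
    if "i \<in> I" "set_pmf \<tau> \<subseteq> S i" for i \<tau>
    unfolding V_def by (rule mixed_payoff_fun_upd[OF I S(1) profile that])
  have payoff_return: "mixed_payoff I U i (\<sigma>(i := return_pmf a)) = V i a"
    if "i \<in> I" "a \<in> S i" for i a
  proof -
    have "(\<Sum>b\<in>S i. pmf (return_pmf a) b * V i b) = (\<Sum>b\<in>S i. if a = b then V i b else 0)"
      by (intro sum.cong) (auto simp: indicator_def)
    then show ?thesis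
      using that bspec[OF S(1) that(1)] by (subst payoff) auto
  qed
  have "nash_equilibrium I S U \<sigma>"
    unfolding nash_equilibrium_def
  proof (intro conjI profile ballI allI impI)
    fix i \<tau> assume i: "i \<in> I" and \<tau>: "set_pmf \<tau> \<subseteq> S i"
    have "(\<Sum>a\<in>S i. pmf \<tau> a * V i a) \<le> (\<Sum>a\<in>S i. pmf \<tau> a * u i)"
      using V_le[OF i] by (intro sum_mono mult_left_mono) auto
    also have "\<dots> = u i"
      using sum_pmf_eq_1[OF bspec[OF S(1) i] \<tau>] by (simp flip: sum_distrib_right)
    also have "\<dots> = mixed_payoff I U i \<sigma>"
      using payoff[OF i \<sigma>(1)[OF i]] by (simp add: u_def)
    finally show "mixed_payoff I U i (\<sigma>(i := \<tau>)) \<le> mixed_payoff I U i \<sigma>"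
      using payoff[OF i \<tau>] by simp
  qed
  moreover have "t \<in> set_pmf (\<sigma> k)" if k: "k \<in> I" and t: "t \<in> pure_best_responses I S U k \<sigma>" for k t
  proof -
    have tS: "t \<in> S k" and best: "\<And>s. s \<in> S k \<Longrightarrow> V k s \<le> V k t"
      using t k by (auto simp: pure_best_responses_def payoff_return)
    \<comment> \<open>The best response property bounds the incentive above by 0, equilibrium bounds
      it below.\<close>
    have tight: "incentive I S U (pmf \<mu>) k s t = 0" if "s \<in> S k" for s
    proof -
      have "pmf (\<sigma> k) s * (V k s - V k t) \<le> 0"
        using best[OF that] by (simp add: mult_nonneg_nonpos)
      then show ?thesis
        using inc_nn[OF k that tS] inc[OF k that] by (simp add: \<mu>)
    qed
    obtain p where p: "p \<in> PiE I S" "p k = t" "pmf \<mu> p > 0"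
      using unique_correlated_equilibrium_best_response_in_support[OF I S unique k tS] tight by blast
    \<comment> \<open>As \<open>\<mu>\<close> is a product, positive probability of \<open>p\<close>
      makes every factor nonzero, in particular the one for \<open>t\<close>.\<close>
    then have "(\<Prod>j\<in>I. pmf (\<sigma> j) (p j)) \<noteq> 0"
      by (simp add: pmf_product_dist[OF I p(1)] flip: \<mu>)
    then have "pmf (\<sigma> k) t \<noteq> 0"
      using k p(2) by (auto simp: prod_zero_iff[OF I])
    then show ?thesis
      by (simp add: set_pmf_iff)
  qed
  ultimately have "quasi_strict_nash_equilibrium I S U \<sigma>"
    by (auto simp: quasi_strict_nash_equilibrium_def)
  then show ?thesis
    using \<mu>[symmetric] by blast
qed

theorem lemma3:
  fixes n :: nat
    and S :: "nat \<Rightarrow> 's set"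
    and U :: "nat \<Rightarrow> (nat \<Rightarrow> 's) \<Rightarrow> real"
    and \<mu> :: "(nat \<Rightarrow> 's) pmf"
  assumes "\<And>i. i \<in> {1..n} \<Longrightarrow> finite (S i)"
    and "\<And>i. i \<in> {1..n} \<Longrightarrow> S i \<noteq> {}"
    and "correlated_equilibrium {1..n} S U \<mu>"
    and "\<And>\<nu>. correlated_equilibrium {1..n} S U \<nu> \<Longrightarrow> \<nu> = \<mu>"
  shows "\<exists>\<sigma>. \<mu> = product_dist {1..n} \<sigma> \<and> quasi_strict_nash_equilibrium {1..n} S U \<sigma>"
proof (rule unique_correlated_equilibrium_quasi_strict)
  show "\<forall>i\<in>{1..n}. finite (S i)" "\<forall>i\<in>{1..n}. S i \<noteq> {}"
    using assms(1,2) by blast+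
  show "\<forall>\<nu>. correlated_equilibrium {1..n} S U \<nu> \<longrightarrow> \<nu> = \<mu>"
    using assms(4) by blast
qed simp

end
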